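(* Let $0<\alpha\le1$ and let $p^\alpha(n,t)$, $n\ge0$, be the state probabilities of the fractional birth-death process (FBDP) with rates $\lambda_n,\mu_n$. Assume that, for each $n\ge0$ and $t\ge0$, $p^\alpha(n,t)=\sum_{k=0}^\infty p_k^\alpha(n,t)$ as an absolutely convergent series, where $p_k^\alpha(n,t)$ are the Adomian series components. Then, with the functions $\psi_{n,k}=\psi_{n,k}\big((\lambda_j)_1^{a_{n,k}},(\mu_j)_1^{b_{n,k}}\big)$ defined in the context, for $n\ge1$, $$p^\alpha(n,t)=\frac{t^{(n-1)\alpha}}{\Gamma((n-1)\alpha+1)}\prod_{j=1}^{n-1}\lambda_j+\sum_{k=n}^\infty(-1)^{k-n+1}\psi_{n,k}\,\frac{t^{k\alpha}}{\Gamma(k\alpha+1)},$$ and the extinction probability is $$p^\alpha(0,t)=\sum_{k=1}^\infty(-1)^{k+1}\psi_{0,k}\,\frac{t^{k\alpha}}{\Gamma(k\alpha+1)}.$$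
   Context: Rates: $\lambda_0=\mu_0=0$ and $\lambda_n,\mu_n\ge0$ for $n\ge1$; $\Lambda_n=\lambda_n+\mu_n$. The rates are assumed such that the classical birth-death process with these rates, started from one individual, is regular (its forward equations have a unique solution, which sums to 1 over states). The FBDP $\{N^\alpha(t)\}_{t\ge0}$ is a process whose state probabilities $p^\alpha(n,t)=\mathrm{Pr}\{N^\alpha(t)=n\}$ solve $$\mathcal{D}_t^\alpha p^\alpha(n,t)=-(\lambda_n+\mu_n)p^\alpha(n,t)+\lambda_{n-1}p^\alpha(n-1,t)+\mu_{n+1}p^\alpha(n+1,t),\ n\ge0,$$ with $p^\alpha(1,0)=1$, $p^\alpha(n,0)=0$ for $n\neq1$, $p^\alpha(-1,t)=0$, where $\mathcal{D}_t^\alpha f(t)=\frac{1}{\Gamma(1-\alpha)}\int_0^t (t-s)^{-\alpha}f'(s)\,\mathrm{d}s$ for $0<\alpha<1$ and $\mathcal{D}^1_tf=f'$ (Caputo derivative). $I_t^\alpha g(t)=\frac{1}{\Gamma(\alpha)}\int_0^t (t-s)^{\alpha-1}g(s)\,\mathrm{d}s$. The Adomian series components are defined by $p_0^\alpha(1,t)=1$, $p_0^\alpha(n,t)=0$ for $n\ne1$, and for $k\ge1$, $n\ge0$, $$p_k^\alpha(n,t)=I_t^\alpha\big(-(\lambda_n+\mu_n)p_{k-1}^\alpha(n,t)+\lambda_{n-1}p_{k-1}^\alpha(n-1,t)+\mu_{n+1}p_{k-1}^\alpha(n+1,t)\big),$$ with $p_k^\alpha(-1,t)=0$. With $[\cdot]$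 the greatest integer function, $a_{n,k}=\left[\frac{n+k}{2}\right]$, and $b_{n,k}=\left[\frac{n+k+1}{2}\right]$ if $n-k\ne1$, $b_{n,k}=0$ if $n-k=1$. The functions $\psi_{n,k}$, $n,k\ge0$, of $\lambda_1,\dots,\lambda_{a_{n,k}},\mu_1,\dots,\mu_{b_{n,k}}$ are defined by $\psi_{0,0}=0$, $\psi_{1,0}=1$, $\psi_{n,0}=0$ for $n\ge2$, $\psi_{0,1}=\mu_1$, and, for $k\ge0$, $$\psi_{n,k+1}=\begin{cases}0,& n>k+2,\\ \mu_1\psi_{1,k},& n=0,\ k\ge1,\\ \Lambda_1\psi_{1,k}+\mu_2\psi_{2,k},& n=1,\ k\ge0,\\ \Lambda_n\psi_{n,k}+\lambda_{n-1}\psi_{n-1,k}+\mu_{n+1}\psi_{n+1,k},& n\ge2,\ k>n-2,\\ \lambda_1\lambda_2\cdots\lambda_{n-1},& n\ge2,\ n-k=2.\end{cases}$$ *)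

theory Defs
  imports "HOL-Probability.Probability"
begin

(* 0 powr 0 = 0 in the library, whereas t^((n-1) alpha) for n = 1 has to be 1 also at t = 0. *)
definition tpow :: "real \<Rightarrow> real \<Rightarrow> real" where
  "tpow t x = (if x = 0 then 1 else t powr x)"

text \<open>Riemann--Liouville integral and Caputo derivative. The functions are only meaningful on
  \<open>{0..}\<close>; the interval integral ignores the end points. The Caputo derivative is accompanied by
  the condition that \<open>f'\<close> exists and that its defining integral is a proper Lebesgue integral,
  since \<^const>\<open>deriv\<close> and the integral are total. No derivative is asked for at \<open>0\<close>: solutions of
  fractional equations typically have none there.\<close>

definition frac_integral :: "real \<Rightarrow> (real \<Rightarrow> real) \<Rightarrow> real \<Rightarrow> real" where
  "frac_integral \<alpha> g t = 1 / Gamma \<alpha> * (LBINT s=0..t. (t - s) powr (\<alpha> - 1) * g s)"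

definition caputo_deriv :: "real \<Rightarrow> (real \<Rightarrow> real) \<Rightarrow> real \<Rightarrow> real" where
  "caputo_deriv \<alpha> f t =
     (if \<alpha> = 1 then deriv f t
      else 1 / Gamma (1 - \<alpha>) * (LBINT s=0..t. (t - s) powr (- \<alpha>) * deriv f s))"

definition caputo_differentiable :: "real \<Rightarrow> (real \<Rightarrow> real) \<Rightarrow> real \<Rightarrow> bool" where
  "caputo_differentiable \<alpha> f t \<longleftrightarrow>
     (\<forall>s\<in>{0<..t}. f differentiable at s) \<and>
     (\<alpha> = 1 \<or> interval_lebesgue_integrable lborel 0 t (\<lambda>s. (t - s) powr (- \<alpha>) * deriv f s))"

text \<open>Right-hand side of the forward equations; the \<open>n - 1\<close> term is absent for \<open>n = 0\<close>,
  as \<open>p(-1,t) = 0\<close>.\<close>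

definition bd_rhs :: "(nat \<Rightarrow> real) \<Rightarrow> (nat \<Rightarrow> real) \<Rightarrow> (nat \<Rightarrow> real) \<Rightarrow> nat \<Rightarrow> real" where
  "bd_rhs lam mu q n =
     - (lam n + mu n) * q n + (if n = 0 then 0 else lam (n - 1) * q (n - 1)) + mu (n + 1) * q (n + 1)"

text \<open>The equation is imposed for \<open>t > 0\<close> (for \<open>\<alpha> < 1\<close> the Caputo integral is \<open>0\<close> at \<open>t = 0\<close>);
  continuity on \<open>{0..}\<close> connects it with the initial condition.\<close>

definition bd_equations ::
    "real \<Rightarrow> (nat \<Rightarrow> real) \<Rightarrow> (nat \<Rightarrow> real) \<Rightarrow> (nat \<Rightarrow> real \<Rightarrow> real) \<Rightarrow> bool" where
  "bd_equations \<alpha> lam mu p \<longleftrightarrow>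
     (\<forall>n. p n 0 = (if n = 1 then 1 else 0)) \<and>
     (\<forall>n. continuous_on {0..} (p n)) \<and>
     (\<forall>n. \<forall>t>0. caputo_differentiable \<alpha> (p n) t \<and>
                 caputo_deriv \<alpha> (p n) t = bd_rhs lam mu (\<lambda>m. p m t) n)"

text \<open>Regularity. Uniqueness is meant among (possibly defective) families of probabilities:
  without nonnegativity the infinite forward system has further solutions, e.g. whenever all
  \<open>mu n\<close> with \<open>n \<ge> 1\<close> are positive.\<close>

definition forward_solution ::
    "(nat \<Rightarrow> real) \<Rightarrow> (nat \<Rightarrow> real) \<Rightarrow> (nat \<Rightarrow> real \<Rightarrow> real) \<Rightarrow> bool" where
  "forward_solution lam mu q \<longleftrightarrow>
     bd_equations 1 lam mu q \<and>
     (\<forall>n. \<forall>t\<ge>0. 0 \<le> q n t) \<and>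
     (\<forall>t\<ge>0. summable (\<lambda>n. q n t) \<and> (\<Sum>n. q n t) \<le> 1)"

definition regular_rates :: "(nat \<Rightarrow> real) \<Rightarrow> (nat \<Rightarrow> real) \<Rightarrow> bool" where
  "regular_rates lam mu \<longleftrightarrow>
     (\<exists>q. forward_solution lam mu q \<and> (\<forall>t\<ge>0. (\<lambda>n. q n t) sums 1)) \<and>
     (\<forall>q q'. forward_solution lam mu q \<longrightarrow> forward_solution lam mu q' \<longrightarrow>
        (\<forall>n. \<forall>t\<ge>0. q n t = q' n t))"

definition bd_rates :: "(nat \<Rightarrow> real) \<Rightarrow> (nat \<Rightarrow> real) \<Rightarrow> bool" where
  "bd_rates lam mu \<longleftrightarrow>
     lam 0 = 0 \<and> mu 0 = 0 \<and> (\<forall>n\<ge>1. 0 \<le> lam n \<and> 0 \<le> mu n) \<and> regular_rates lam mu"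

definition state_prob :: "'a measure \<Rightarrow> (real \<Rightarrow> 'a \<Rightarrow> nat) \<Rightarrow> nat \<Rightarrow> real \<Rightarrow> real" where
  "state_prob M N n t = measure M {x \<in> space M. N t x = n}"

definition fbdp ::
    "real \<Rightarrow> (nat \<Rightarrow> real) \<Rightarrow> (nat \<Rightarrow> real) \<Rightarrow> 'a measure \<Rightarrow> (real \<Rightarrow> 'a \<Rightarrow> nat) \<Rightarrow> bool" where
  "fbdp \<alpha> lam mu M N \<longleftrightarrow>
     prob_space M \<and> (\<forall>t\<ge>0. N t \<in> measurable M (count_space UNIV)) \<and>
     bd_equations \<alpha> lam mu (state_prob M N)"

text \<open>\<open>adomian \<alpha> lam mu k n t\<close> is the component \<open>p\<^sub>k(n,t)\<close>.\<close>

primrec adomian ::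
    "real \<Rightarrow> (nat \<Rightarrow> real) \<Rightarrow> (nat \<Rightarrow> real) \<Rightarrow> nat \<Rightarrow> nat \<Rightarrow> real \<Rightarrow> real" where
  "adomian \<alpha> lam mu 0 = (\<lambda>n t. if n = 1 then 1 else 0)"
| "adomian \<alpha> lam mu (Suc k) =
     (\<lambda>n. frac_integral \<alpha> (\<lambda>s. bd_rhs lam mu (\<lambda>m. adomian \<alpha> lam mu k m s) n))"

text \<open>\<open>psi\<close> is written for whole rate sequences; \<open>psi_first\<close> below shows that \<open>psi lam mu n k\<close>
  is a function of \<open>lam 1, \<dots>, lam (a_idx n k)\<close> and \<open>mu 1, \<dots>, mu (b_idx n k)\<close> only.\<close>

fun psi :: "(nat \<Rightarrow> real) \<Rightarrow> (nat \<Rightarrow> real) \<Rightarrow> nat \<Rightarrow> nat \<Rightarrow> real" where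
  "psi lam mu n 0 = (if n = 1 then 1 else 0)"
| "psi lam mu n (Suc k) =
     (if n > k + 2 then 0
      else if n = 0 then (if k = 0 then mu 1 else mu 1 * psi lam mu 1 k)
      else if n = 1 then (lam 1 + mu 1) * psi lam mu 1 k + mu 2 * psi lam mu 2 k
      else if n < k + 2 then
        (lam n + mu n) * psi lam mu n k + lam (n - 1) * psi lam mu (n - 1) k
          + mu (n + 1) * psi lam mu (n + 1) k
      else (\<Prod>j=1..n-1. lam j))"

definition a_idx :: "nat \<Rightarrow> nat \<Rightarrow> nat" where
  "a_idx n k = (n + k) div 2"

definition b_idx :: "nat \<Rightarrow> nat \<Rightarrow> nat" where
  "b_idx n k = (if n = k + 1 then 0 else (n + k + 1) div 2)"

text \<open>The finite sequence \<open>f 1, \<dots>, f m\<close>, padded with zeros.\<close>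

definition first :: "nat \<Rightarrow> (nat \<Rightarrow> real) \<Rightarrow> nat \<Rightarrow> real" where
  "first m f j = (if 1 \<le> j \<and> j \<le> m then f j else 0)"

lemma psi_eq_0: "n > k + 1 \<Longrightarrow> psi lam mu n k = 0"
  by (cases k) auto

lemma psi_cong:
  assumes "\<And>j. 1 \<le> j \<Longrightarrow> j \<le> a_idx n k \<Longrightarrow> lam j = lam' j"
    and "\<And>j. 1 \<le> j \<Longrightarrow> j \<le> b_idx n k \<Longrightarrow> mu j = mu' j"
  shows "psi lam mu n k = psi lam' mu' n k"
  using assms
proof (induction k arbitrary: n)
  case 0
  then show ?case by simp
next
  case (Suc k)
  have step: "psi lam mu m k = psi lam' mu' m k"
    if "a_idx m k \<le> a_idx n (Suc k)" "b_idx m k \<le> b_idx n (Suc k)" for m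
    using that by (intro Suc.IH Suc.prems) auto
  consider "n > k + 2" | "n = 0" | "n = 1" | "n \<ge> 2" "n < k + 2" | "n \<ge> 2" "n = k + 2"
    by linarith
  then show ?case
  proof cases
    case 1
    then show ?thesis by simp
  next
    case 2
    have "mu 1 = mu' 1" using 2 by (intro Suc.prems) (auto simp: b_idx_def)
    moreover have "psi lam mu 1 k = psi lam' mu' 1 k"
      using 2 by (intro step) (auto simp: a_idx_def b_idx_def)
    ultimately show ?thesis using 2 by simp
  next
    case 3
    have "lam 1 = lam' 1" "mu 1 = mu' 1"
      using 3 by (intro Suc.prems; simp add: a_idx_def b_idx_def)+
    moreover have "psi lam mu 1 k = psi lam' mu' 1 k"
      using 3 by (intro step) (auto simp: a_idx_def b_idx_def)
    moreover have "mu 2 * psi lam mu 2 k = mu' 2 * psi lam' mu' 2 k"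
    proof (cases "k = 0")
      case False
      have "mu 2 = mu' 2" using 3 False by (intro Suc.prems) (auto simp: b_idx_def)
      moreover have "psi lam mu 2 k = psi lam' mu' 2 k"
        using 3 by (intro step) (auto simp: a_idx_def b_idx_def)
      ultimately show ?thesis by simp
    qed simp
    ultimately show ?thesis using 3 by simp
  next
    case 4
    have "lam n = lam' n" "mu n = mu' n" "lam (n - 1) = lam' (n - 1)"
      using 4 by (intro Suc.prems; simp add: a_idx_def b_idx_def; linarith)+
    moreover have "psi lam mu n k = psi lam' mu' n k"
      using 4 by (intro step) (auto simp: a_idx_def b_idx_def)
    moreover have "psi lam mu (n - 1) k = psi lam' mu' (n - 1) k"
      using 4 by (intro step) (auto simp: a_idx_def b_idx_def)
    moreover have "mu (n + 1) * psi lam mu (n + 1) k = mu' (n + 1) * psi lam' mu' (n + 1) k"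
    proof (cases "n = k + 1")
      case True
      then show ?thesis by (simp add: psi_eq_0)
    next
      case False
      have "mu (n + 1) = mu' (n + 1)"
        using 4 False by (intro Suc.prems) (auto simp: b_idx_def)
      moreover have "psi lam mu (n + 1) k = psi lam' mu' (n + 1) k"
        using 4 by (intro step) (auto simp: a_idx_def b_idx_def)
      ultimately show ?thesis by simp
    qed
    ultimately show ?thesis using 4 by simp
  next
    case 5
    have "lam j = lam' j" if "j \<in> {1..n-1}" for j
      using 5 that by (intro Suc.prems) (auto simp: a_idx_def)
    then have "(\<Prod>j=1..n-1. lam j) = (\<Prod>j=1..n-1. lam' j)"
      by (intro prod.cong) auto
    then show ?thesis using 5 by simp
  qed
qed

lemma psi_first: "psi (first (a_idx n k) lam) (first (b_idx n k) mu) n k = psi lam mu n k"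
  by (rule psi_cong) (auto simp: first_def)

end

theory Submission imports Defs begin

text \<open>
  The Riemann--Liouville integral maps \<open>t\<^sup>b / \<Gamma>(b + 1)\<close> to \<open>t\<^sup>b\<^sup>+\<^sup>\<alpha> / \<Gamma>(b + \<alpha> + 1)\<close>: after rescaling
  to the unit interval this is the Euler beta integral, and the Gamma factors cancel
  (\<open>frac_integral_monomial\<close>). Hence every Adomian component is a single monomial
  \<open>c\<^sub>n\<^sub>,\<^sub>k t\<^sup>k\<^sup>\<alpha> / \<Gamma>(k\<alpha> + 1)\<close>, whose coefficients obey the recursion
  \<open>c\<^sub>n\<^sub>,\<^sub>k\<^sub>+\<^sub>1 = bd_rhs c\<^sub>\<cdot>\<^sub>,\<^sub>k n\<close> in which time no longer occurs.

  The only negative coefficient on the right-hand side of the forward equations is the diagonal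
  one, while the two neighbour terms change the parity of \<open>n\<close>. The sign pattern
  \<open>(-1)\<^sup>k\<^sup>+\<^sup>n\<^sup>+\<^sup>1\<close> is therefore preserved by the recursion, and stripping it off leaves the
  recursion with nonnegative coefficients that defines \<^const>\<open>psi\<close> (\<open>bd_rhs_psi\<close>).

  The components of order \<open>k < n - 1\<close> vanish, since \<open>n - 1\<close> births are needed to reach \<open>n\<close>
  from \<open>1\<close>; the component of order \<open>k = n - 1\<close> uses births only and is the separate leading term.
  The representation is then the assumed series, with these terms taken out.
\<close>

lemma LBINT_beta_kernel:
  fixes a b t :: real
  assumes "a > 0" "b > -1" "t > 0"
  shows "(LBINT s=0..t. (t - s) powr (a - 1) * s powr b) = t powr (a + b) * Beta a (b + 1)"
proof -
  let ?f = "\<lambda>s. (t - s) powr (a - 1) * s powr b"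
  have img: "(\<lambda>x. x / (1 / t)) ` {0..1} = {0..t}"
    using \<open>t > 0\<close> image_mult_atLeastAtMost[of t 0 1] by (simp add: mult.commute[of _ t])
  have "((\<lambda>x. x powr (b + 1 - 1) * (1 - x) powr (a - 1)) has_integral Beta (b + 1) a) {0..1}"
    using assms by (intro has_integral_Beta_real) auto
  from has_integral_stretch_real[OF this, of "1 / t"]
  have "((\<lambda>x. (x / t) powr b * (1 - x / t) powr (a - 1)) has_integral (t * Beta a (b + 1))) {0..t}"
    using \<open>t > 0\<close> by (simp only: img) (simp add: Beta_commute)
  from has_integral_mult_right[OF this, of "t powr (a + b - 1)"]
  have "((\<lambda>x. t powr (a + b - 1) * ((x / t) powr b * (1 - x / t) powr (a - 1)))
          has_integral (t powr (a + b - 1) * (t * Beta a (b + 1)))) {0..t}" .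
  moreover have "t powr (a + b - 1) * ((x / t) powr b * (1 - x / t) powr (a - 1)) = ?f x"
    if "x \<in> {0..t}" for x
  proof -
    have "1 - x / t = (t - x) / t" using \<open>t > 0\<close> by (simp add: field_simps)
    moreover have "t powr (a + b - 1) = t powr (a - 1) * t powr b"
      by (simp add: powr_add[symmetric] algebra_simps)
    ultimately show ?thesis using that \<open>t > 0\<close> by (simp add: powr_divide)
  qed
  moreover have "t powr (a + b - 1) * (t * Beta a (b + 1)) = t powr (a + b) * Beta a (b + 1)"
    using \<open>t > 0\<close> by (simp add: powr_diff)
  ultimately have int: "(?f has_integral (t powr (a + b) * Beta a (b + 1))) {0..t}"
    by (metis (no_types, lifting) has_integral_cong)
  \<comment> \<open>The kernel is singular at \<open>t\<close> when \<open>a < 1\<close>; nonnegativity turns the Henstock--Kurzweil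
    integral into a Lebesgue integral.\<close>
  have "?f absolutely_integrable_on {0..t}"
    using int by (intro nonnegative_absolutely_integrable_1) (auto intro: has_integral_integrable)
  then have "set_integrable lborel {0..t} ?f"
    unfolding set_integrable_def by (subst (asm) integrable_completion) measurable
  then have "(LBINT s:{0..t}. ?f s) = integral {0..t} ?f"
    by (rule set_borel_integral_eq_integral)
  then show ?thesis
    using int \<open>t > 0\<close> by (simp add: zero_ereal_def interval_integral_Icc integral_unique)
qed

lemma frac_integral_monomial:
  assumes "\<alpha> > 0" "b \<ge> 0" "t \<ge> 0"
    and g: "\<And>s. 0 < s \<Longrightarrow> s < t \<Longrightarrow> g s = c * (tpow s b / Gamma (b + 1))"
  shows "frac_integral \<alpha> g t = c * (tpow t (b + \<alpha>) / Gamma (b + \<alpha> + 1))"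
proof (cases "t = 0")
  case True
  then show ?thesis using assms
    by (simp add: frac_integral_def tpow_def flip: zero_ereal_def)
next
  case False
  with \<open>t \<ge> 0\<close> have "t > 0" by simp
  have pos: "Gamma \<alpha> > 0" "Gamma (b + 1) > 0"
    using assms by (auto intro!: Gamma_real_pos)
  have "(LBINT s=0..t. (t - s) powr (\<alpha> - 1) * g s)
      = (LBINT s=0..t. c / Gamma (b + 1) * ((t - s) powr (\<alpha> - 1) * s powr b))"
    using \<open>t > 0\<close> by (intro interval_integral_cong) (auto simp: einterval_def zero_ereal_def min_def g tpow_def)
  also have "\<dots> = c / Gamma (b + 1) * (t powr (\<alpha> + b) * Beta \<alpha> (b + 1))"
    using LBINT_beta_kernel[of \<alpha> b t] assms \<open>t > 0\<close> by simp
  also have "\<dots> = Gamma \<alpha> * (c * (t powr (b + \<alpha>) / Gamma (b + \<alpha> + 1)))"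
    using pos by (simp add: Beta_def add_ac)
  finally show ?thesis
    using \<open>\<alpha> > 0\<close> \<open>b \<ge> 0\<close> less_imp_neq[OF pos(1)] by (simp add: frac_integral_def tpow_def)
qed

lemma psi_leading: "n \<ge> 1 \<Longrightarrow> psi lam mu n (n - 1) = (\<Prod>j=1..n-1. lam j)"
  by (cases "n - 1") auto

text \<open>For \<open>2 \<le> n < k + 2\<close> this is the defining recursion of \<^const>\<open>psi\<close>. The boundary clauses
  agree with it because \<open>lam 0 = mu 0 = 0\<close> removes the diagonal term at \<open>n = 0\<close> and the birth term
  at \<open>n = 1\<close>; for \<open>n = k + 2\<close> only the birth term survives, which produces the product of the
  birth rates.\<close>

lemma bd_rhs_psi:
  assumes "lam 0 = 0" "mu 0 = 0"
  shows "bd_rhs lam mu (\<lambda>m. (-1) ^ (k + m + 1) * psi lam mu m k) n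
       = (-1) ^ (Suc k + n + 1) * psi lam mu n (Suc k)"
proof -
  consider "n > k + 2" | "n = 0" | "n = 1" | "n \<ge> 2" "n < k + 2" | "n = k + 2"
    by linarith
  then show ?thesis
  proof cases
    case 1
    then show ?thesis by (simp add: bd_rhs_def psi_eq_0 del: psi.simps(1))
  next
    case 2
    then show ?thesis using assms by (simp add: bd_rhs_def)
  next
    case 3
    then show ?thesis using assms by (simp add: bd_rhs_def numeral_2_eq_2 algebra_simps)
  next
    case 4
    then obtain m where "n = Suc m" "m \<ge> 1" by (cases n) auto
    then show ?thesis using 4 by (simp add: bd_rhs_def algebra_simps)
  next
    case 5
    have "psi lam mu (Suc k) k = (\<Prod>j=1..k. lam j)" using psi_leading[of "Suc k" lam mu] by simp
    then show ?thesis using 5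
      by (simp add: bd_rhs_def psi_eq_0 power_add mult_ac del: psi.simps(1))
  qed
qed

lemma bd_rhs_mult_right: "bd_rhs lam mu (\<lambda>m. q m * x) n = bd_rhs lam mu q n * x"
  by (simp add: bd_rhs_def algebra_simps)

lemma adomian_eq_psi:
  assumes "\<alpha> > 0" "lam 0 = 0" "mu 0 = 0" "t \<ge> 0"
  shows "adomian \<alpha> lam mu k n t
       = (-1) ^ (k + n + 1) * psi lam mu n k * (tpow t (real k * \<alpha>) / Gamma (real k * \<alpha> + 1))"
  using \<open>t \<ge> 0\<close>
proof (induction k arbitrary: n t)
  case 0
  then show ?case by (simp add: tpow_def)
next
  case (Suc k)
  let ?c = "(-1) ^ (Suc k + n + 1) * psi lam mu n (Suc k)"
  have "bd_rhs lam mu (\<lambda>m. adomian \<alpha> lam mu k m s) n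
      = ?c * (tpow s (real k * \<alpha>) / Gamma (real k * \<alpha> + 1))" if "0 < s" for s
    using that by (simp only: Suc.IH[OF less_imp_le] bd_rhs_mult_right bd_rhs_psi[of lam mu, OF assms(2,3)])
  then have "adomian \<alpha> lam mu (Suc k) n t
      = ?c * (tpow t (real k * \<alpha> + \<alpha>) / Gamma (real k * \<alpha> + \<alpha> + 1))"
    using Suc.prems \<open>\<alpha> > 0\<close> unfolding adomian.simps by (intro frac_integral_monomial) auto
  moreover have "real (Suc k) * \<alpha> = real k * \<alpha> + \<alpha>" by (simp add: algebra_simps)
  ultimately show ?case by simp
qed

theorem theorem3p3:
  fixes \<alpha> :: real and lam mu :: "nat \<Rightarrow> real"
    and M :: "'a measure" and N :: "real \<Rightarrow> 'a \<Rightarrow> nat"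
  assumes "0 < \<alpha>" and "\<alpha> \<le> 1"
    and "bd_rates lam mu"
    and "fbdp \<alpha> lam mu M N"
    and "\<And>n t. 0 \<le> t \<Longrightarrow>
           summable (\<lambda>k. \<bar>adomian \<alpha> lam mu k n t\<bar>) \<and>
           (\<lambda>k. adomian \<alpha> lam mu k n t) sums state_prob M N n t"
  shows "(\<forall>n\<ge>1. \<forall>t\<ge>0.
           ((\<lambda>k. (-1) ^ (k - n + 1) * psi (first (a_idx n k) lam) (first (b_idx n k) mu) n k
                 * (tpow t (real k * \<alpha>) / Gamma (real k * \<alpha> + 1)))
            has_sum
              (state_prob M N n t
                - tpow t (real (n - 1) * \<alpha>) / Gamma (real (n - 1) * \<alpha> + 1) * (\<Prod>j=1..n-1. lam j)))
           {n..}) \<and>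
         (\<forall>t\<ge>0.
           ((\<lambda>k. (-1) ^ (k + 1) * psi (first (a_idx 0 k) lam) (first (b_idx 0 k) mu) 0 k
                 * (tpow t (real k * \<alpha>) / Gamma (real k * \<alpha> + 1)))
            has_sum state_prob M N 0 t) {1..})"
proof -
  let ?c = "\<lambda>n k t. (-1) ^ (k + n + 1) * psi lam mu n k
                      * (tpow t (real k * \<alpha>) / Gamma (real k * \<alpha> + 1))"
  have zero: "lam 0 = 0" "mu 0 = 0" using assms(3) by (auto simp: bd_rates_def)
  have series: "((\<lambda>k. ?c n k t) has_sum state_prob M N n t) UNIV" if "t \<ge> 0" for n t
    using norm_summable_imp_has_sum[of "\<lambda>k. adomian \<alpha> lam mu k n t"] assms(5)[OF that, of n]
    by (simp add: adomian_eq_psi[of \<alpha> lam mu, OF assms(1) zero that])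
  have pos_states: "((\<lambda>k. (-1) ^ (k - n + 1) * psi lam mu n k
                 * (tpow t (real k * \<alpha>) / Gamma (real k * \<alpha> + 1)))
            has_sum (state_prob M N n t
                - tpow t (real (n - 1) * \<alpha>) / Gamma (real (n - 1) * \<alpha> + 1) * (\<Prod>j=1..n-1. lam j)))
           {n..}" if "n \<ge> 1" "t \<ge> 0" for n t
  proof -
    have "((\<lambda>k. ?c n k t) has_sum ?c n (n - 1) t) {n - 1}"
      by (rule has_sum_finiteI) auto
    from has_sum_Diff[OF series[OF \<open>t \<ge> 0\<close>] this]
    have "((\<lambda>k. ?c n k t) has_sum (state_prob M N n t - ?c n (n - 1) t)) (UNIV - {n - 1})"
      by simp
    moreover have "?c n (n - 1) t
        = tpow t (real (n - 1) * \<alpha>) / Gamma (real (n - 1) * \<alpha> + 1) * (\<Prod>j=1..n-1. lam j)"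
    proof -
      have "(-1) ^ (n - 1 + n + 1) = (1 :: real)"
        using \<open>n \<ge> 1\<close> by (simp add: minus_one_power_iff)
      then show ?thesis using psi_leading[OF \<open>n \<ge> 1\<close>, of lam mu] by simp
    qed
    \<comment> \<open>The indices \<open>k < n - 1\<close> contribute \<open>0\<close>; for \<open>k \<ge> n\<close> the exponents \<open>k + n + 1\<close> and
      \<open>k - n + 1\<close> have the same parity.\<close>
    moreover have "((\<lambda>k. ?c n k t) has_sum S) (UNIV - {n - 1}) \<longleftrightarrow>
       ((\<lambda>k. (-1) ^ (k - n + 1) * psi lam mu n k
                 * (tpow t (real k * \<alpha>) / Gamma (real k * \<alpha> + 1))) has_sum S) {n..}" for S
      by (rule has_sum_cong_neutral)
        (use \<open>n \<ge> 1\<close> in \<open>auto simp: psi_eq_0 minus_one_power_iff simp del: psi.simps\<close>)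
    ultimately show ?thesis by (simp only:)
  qed
  have extinct: "((\<lambda>k. (-1) ^ (k + 1) * psi lam mu 0 k
                 * (tpow t (real k * \<alpha>) / Gamma (real k * \<alpha> + 1)))
            has_sum state_prob M N 0 t) {1..}" if "t \<ge> 0" for t
  proof -
    have "((\<lambda>k. ?c 0 k t) has_sum S) UNIV \<longleftrightarrow>
       ((\<lambda>k. (-1) ^ (k + 1) * psi lam mu 0 k
                 * (tpow t (real k * \<alpha>) / Gamma (real k * \<alpha> + 1))) has_sum S) {1..}" for S
      by (rule has_sum_cong_neutral) (auto simp: not_le)
    then show ?thesis using series[OF that, of 0] by simp
  qed
  show ?thesis
    using pos_states extinct by (simp add: psi_first del: psi.simps)
qed

end
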